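(* Let $D\subset\mathbb{R}^d$ be a bounded Lipschitz domain, let the kernel $\mathcal{K}\colon D\times D\to\mathbb{R}$ be $\mathcal{P}_q$-conditionally positive definite (respectively positive semidefinite), let $X=\{\boldsymbol{x}_1,\dots,\boldsymbol{x}_N\}\subset D$ be a $\mathcal{P}_q$-unisolvent set of pairwise distinct data sites, and consider a samplet basis for $X$ with at least $q+1$ vanishing moments. Then the matrix $\boldsymbol{K}_{\Psi\Psi}=(\boldsymbol{I}-\boldsymbol{Q})\boldsymbol{K}^{\Sigma}(\boldsymbol{I}-\boldsymbol{Q})$, regarded as an $(N-n)\times(N-n)$ matrix acting on the range of $\boldsymbol{I}-\boldsymbol{Q}$ (equivalently, the block of $\boldsymbol{K}^\Sigma$ left after deleting its first $n$ rows and columns), is positive definite (respectively positive semidefinite).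
   Context: $\mathcal{P}_q$ is the space of $d$-variate polynomials of total degree at most $q$, with basis $p_1,\dots,p_n$, $n=\dim\mathcal{P}_q$. $X$ is $\mathcal{P}_q$-unisolvent if $\boldsymbol{P}=[p_j(\boldsymbol{x}_i)]_{i=1,\dots,N;\,j=1,\dots,n}\in\mathbb{R}^{N\times n}$ has full column rank. A symmetric function $\mathcal{K}\colon D\times D\to\mathbb{R}$ is $\mathcal{P}_q$-conditionally positive semidefinite if for every $N\in\mathbb{N}$ and pairwise distinct $\boldsymbol{x}_1,\dots,\boldsymbol{x}_N\in D$ one has $\boldsymbol{c}^\intercal\boldsymbol{K}\boldsymbol{c}\ge0$ for all $\boldsymbol{c}\in\ker\boldsymbol{P}^\intercal$, where $\boldsymbol{K}=[\mathcal{K}(\boldsymbol{x}_i,\boldsymbol{x}_j)]_{i,j=1}^N$; it is $\mathcal{P}_q$-conditionally positive definite if the inequality is strict unless $\boldsymbol{c}=\boldsymbol{0}$. Samplets: let $\mathcal{X}'=\operatorname{span}\{\delta_{\boldsymbol{x}}:\boldsymbol{x}\in X\}$ with inner product $\langle\delta_{\boldsymbol{x}_i},\delta_{\boldsymbol{x}_j}\rangle_{\mathcal{X}'}=\delta_{ij}$. Given a multiresolution analysis $\mathcal{X}_0'\subset\mathcal{X}_1'\subset\cdots\subset\mathcal{X}_J'=\mathcal{X}'$ with orthogonal decompositions $\mathcal{X}_{j+1}'=\mathcal{X}_j'\oplus\mathcal{S}_j'$, a samplet basis is an orthonormal basis of $\mathcal{X}'$ consisting of an orthonormal basis of $\mathcal{X}_0'$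 (the scaling distributions) and orthonormal bases of the detail spaces $\mathcal{S}_j'$ (the samplets). It has at least $q+1$ vanishing moments if $\sigma(p)=0$ for all samplets $\sigma$ (elements of the $\mathcal{S}_j'$) and all $p\in\mathcal{P}_q$. The samplet transform $\boldsymbol{T}\in\mathbb{R}^{N\times N}$ is the orthogonal matrix whose rows are the coefficient vectors of the basis elements with respect to $\delta_{\boldsymbol{x}_1},\dots,\delta_{\boldsymbol{x}_N}$. The scaling distributions come first and are ordered by increasing degree: they correspond to the discrete orthogonal polynomials with respect to the sample measure at $X$ evaluated at $X$, so that they have successively more vanishing moments. Hence all basis elements except the first $n$ annihilate $\mathcal{P}_q$, i.e. $$\boldsymbol{T}\boldsymbol{P}=\begin{bmatrix}\boldsymbol{R}\\ \boldsymbol{0}\end{bmatrix}$$ with $\boldsymbol{R}\in\mathbb{R}^{n\times n}$ invertible. Matrices: $\boldsymbol{K}^\Sigma=\boldsymbol{T}\boldsymbol{K}\boldsymbol{T}^\intercal$ is the samplet-transformed kernel matrix. $\boldsymbol{Q}$ is the orthogonal projector onto the range of $\boldsymbol{P}$ expressed in samplet coordinates, i.e. the orthogonal projector onto the range of $\boldsymbol{T}\boldsymbol{P}$, so that $\boldsymbol{Q}=\operatorname{diag}(\boldsymbol{I}_n,\boldsymbol{0})$ and $\boldsymbol{I}-\boldsymbol{Q}=\operatorname{diag}(\boldsymbol{0},\boldsymbol{I}_{N-n})$. Correspondingly, $\boldsymbol{K}^\Sigma=\begin{bmatrix}\boldsymbol{K}_{PP}&\boldsymbol{K}_{P\Psi}\\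 \boldsymbol{K}_{\Psi P}&\boldsymbol{K}_{\Psi\Psi}\end{bmatrix}$ with $\boldsymbol{K}_{PP}\in\mathbb{R}^{n\times n}$ and $\boldsymbol{K}_{\Psi\Psi}\in\mathbb{R}^{(N-n)\times(N-n)}$. *)

theory Defs
  imports
    "HOL-Analysis.Analysis"
    "HOL-Library.Function_Algebras"
    "Jordan_Normal_Form.DL_Rank"
    "Jordan_Normal_Form.Matrix_Kernel"
begin

unbundle no inner_syntax
unbundle no vec_syntax

text \<open>Matrices whose size depends on the data are those of \<^theory>\<open>Jordan_Normal_Form.Matrix\<close>,
  indexed from 0. Points of \<open>\<real>\<^sup>d\<close> have type \<^typ>\<open>real ^ 'd\<close>.\<close>

text \<open>Functions into a real vector space form a real vector space with pointwise operations. This is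
  used both for polynomial functions and for functionals acting on functions.\<close>

instantiation "fun" :: (type, real_vector) real_vector
begin

definition scaleR_fun_def: "scaleR c f = (\<lambda>x. scaleR c (f x))"

instance
  by standard
    (simp_all add: scaleR_fun_def fun_eq_iff plus_fun_def scaleR_add_right scaleR_add_left)

end


section \<open>Lipschitz domains\<close>

text \<open>Near each boundary point \<open>z\<close>, in suitable Cartesian coordinates centred at \<open>z\<close> whose last axis
  is the unit vector \<open>e\<close>, the set is the strict epigraph of a Lipschitz function \<open>g\<close> of the remaining
  coordinates, that is, of the component orthogonal to \<open>e\<close>.\<close>

definition lipschitz_domain :: "(real ^ 'd) set \<Rightarrow> bool" where
  "lipschitz_domain D \<longleftrightarrow> open D \<and> connected D \<and> D \<noteq> {} \<and>
     (\<forall>z \<in> frontier D. \<exists>r > 0. \<exists>e L g.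
        norm e = 1 \<and> L-lipschitz_on {y. inner y e = 0} g \<and>
        D \<inter> ball z r =
          {x \<in> ball z r. g (x - z - inner (x - z) e *\<^sub>R e) < inner (x - z) e})"


section \<open>Polynomials and kernels\<close>

definition poly_space :: "nat \<Rightarrow> (real ^ 'd \<Rightarrow> real) set" where
  "poly_space q =
     span {(\<lambda>x. \<Prod>i\<in>UNIV. vec_nth x i ^ \<alpha> i) | \<alpha> :: 'd \<Rightarrow> nat. (\<Sum>i\<in>UNIV. \<alpha> i) \<le> q}"

definition poly_basis :: "nat \<Rightarrow> (real ^ 'd \<Rightarrow> real) list \<Rightarrow> bool" where
  "poly_basis q ps \<longleftrightarrow> distinct ps \<and> independent (set ps) \<and> span (set ps) = poly_space q"

definition poly_mat :: "('a \<Rightarrow> real) list \<Rightarrow> 'a list \<Rightarrow> real mat" where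
  "poly_mat ps xs = mat (length xs) (length ps) (\<lambda>(i, j). (ps ! j) (xs ! i))"

definition unisolvent :: "('a \<Rightarrow> real) list \<Rightarrow> 'a list \<Rightarrow> bool" where
  "unisolvent ps xs \<longleftrightarrow> vec_space.rank (length xs) (poly_mat ps xs) = length ps"

definition kernel_mat :: "('a \<Rightarrow> 'a \<Rightarrow> real) \<Rightarrow> 'a list \<Rightarrow> real mat" where
  "kernel_mat K xs = mat (length xs) (length xs) (\<lambda>(i, j). K (xs ! i) (xs ! j))"

definition symmetric_on :: "'a set \<Rightarrow> ('a \<Rightarrow> 'a \<Rightarrow> real) \<Rightarrow> bool" where
  "symmetric_on D K \<longleftrightarrow> (\<forall>x \<in> D. \<forall>y \<in> D. K x y = K y x)"

text \<open>The polynomial space enters through a basis \<open>ps\<close> of it; \<open>ker P\<^sup>T\<close> does not depend on which one.\<close>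

definition cond_pos_semidef :: "('a \<Rightarrow> real) list \<Rightarrow> 'a set \<Rightarrow> ('a \<Rightarrow> 'a \<Rightarrow> real) \<Rightarrow> bool" where
  "cond_pos_semidef ps D K \<longleftrightarrow> symmetric_on D K \<and>
     (\<forall>xs. distinct xs \<and> set xs \<subseteq> D \<longrightarrow>
        (\<forall>c \<in> mat_kernel (transpose_mat (poly_mat ps xs)). c \<bullet> (kernel_mat K xs *\<^sub>v c) \<ge> 0))"

definition cond_pos_def :: "('a \<Rightarrow> real) list \<Rightarrow> 'a set \<Rightarrow> ('a \<Rightarrow> 'a \<Rightarrow> real) \<Rightarrow> bool" where
  "cond_pos_def ps D K \<longleftrightarrow> symmetric_on D K \<and>
     (\<forall>xs. distinct xs \<and> set xs \<subseteq> D \<longrightarrow>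
        (\<forall>c \<in> mat_kernel (transpose_mat (poly_mat ps xs)).
           c \<noteq> 0\<^sub>v (length xs) \<longrightarrow> c \<bullet> (kernel_mat K xs *\<^sub>v c) > 0))"


section \<open>Samplets\<close>

definition dirac :: "'a \<Rightarrow> ('a \<Rightarrow> real) \<Rightarrow> real" where
  "dirac x = (\<lambda>f. f x)"

definition dual_space :: "'a list \<Rightarrow> (('a \<Rightarrow> real) \<Rightarrow> real) set" where
  "dual_space xs = span (dirac ` set xs)"

definition dirac_coeff :: "'a list \<Rightarrow> (('a \<Rightarrow> real) \<Rightarrow> real) \<Rightarrow> 'a \<Rightarrow> real" where
  "dirac_coeff xs \<sigma> x = representation (dirac ` set xs) \<sigma> (dirac x)"

text \<open>The inner product on the dual space for which the Dirac functionals at the sites are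
  orthonormal.\<close>

definition dual_inner ::
  "'a list \<Rightarrow> (('a \<Rightarrow> real) \<Rightarrow> real) \<Rightarrow> (('a \<Rightarrow> real) \<Rightarrow> real) \<Rightarrow> real" where
  "dual_inner xs \<sigma> \<tau> = (\<Sum>x\<in>set xs. dirac_coeff xs \<sigma> x * dirac_coeff xs \<tau> x)"

definition orthonormal_basis ::
  "'a list \<Rightarrow> (('a \<Rightarrow> real) \<Rightarrow> real) set \<Rightarrow> (('a \<Rightarrow> real) \<Rightarrow> real) list \<Rightarrow> bool" where
  "orthonormal_basis xs U bs \<longleftrightarrow> span (set bs) = U \<and>
     (\<forall>i < length bs. \<forall>j < length bs.
        dual_inner xs (bs ! i) (bs ! j) = (if i = j then 1 else 0))"

definition multiresolution ::
  "'a list \<Rightarrow> nat \<Rightarrow> (nat \<Rightarrow> (('a \<Rightarrow> real) \<Rightarrow> real) set) \<Rightarrow> bool" where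
  "multiresolution xs J V \<longleftrightarrow>
     (\<forall>j \<le> J. real_vector.subspace (V j)) \<and> (\<forall>j < J. V j \<subseteq> V (Suc j)) \<and> V J = dual_space xs"

definition detail_space ::
  "'a list \<Rightarrow> (nat \<Rightarrow> (('a \<Rightarrow> real) \<Rightarrow> real) set) \<Rightarrow> nat \<Rightarrow> (('a \<Rightarrow> real) \<Rightarrow> real) set" where
  "detail_space xs V j = {\<sigma> \<in> V (Suc j). \<forall>\<tau> \<in> V j. dual_inner xs \<sigma> \<tau> = 0}"

text \<open>\<open>fs\<close> are the scaling distributions and \<open>gs\<close> the samplets, the latter in any order.\<close>

definition samplet_basis ::
  "'a list \<Rightarrow> nat \<Rightarrow> (nat \<Rightarrow> (('a \<Rightarrow> real) \<Rightarrow> real) set) \<Rightarrow>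
   (('a \<Rightarrow> real) \<Rightarrow> real) list \<Rightarrow> (('a \<Rightarrow> real) \<Rightarrow> real) list \<Rightarrow> bool" where
  "samplet_basis xs J V fs gs \<longleftrightarrow>
     multiresolution xs J V \<and>
     orthonormal_basis xs (dual_space xs) (fs @ gs) \<and>
     orthonormal_basis xs (V 0) fs \<and>
     set gs \<subseteq> (\<Union>j<J. detail_space xs V j) \<and>
     (\<forall>j < J. orthonormal_basis xs (detail_space xs V j)
                (filter (\<lambda>\<sigma>. \<sigma> \<in> detail_space xs V j) gs))"

text \<open>At least \<open>q + 1\<close> vanishing moments.\<close>

definition vanishing_moments ::
  "nat \<Rightarrow> (real ^ 'd) list \<Rightarrow> nat \<Rightarrow> (nat \<Rightarrow> ((real ^ 'd \<Rightarrow> real) \<Rightarrow> real) set) \<Rightarrow> bool" where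
  "vanishing_moments q xs J V \<longleftrightarrow>
     (\<forall>j < J. \<forall>\<sigma> \<in> detail_space xs V j. \<forall>p \<in> poly_space q. \<sigma> p = 0)"

text \<open>The inner product of \<open>L\<^sup>2\<close> with respect to the sample measure
  \<open>(1/N) \<Sum>\<^sub>x \<delta>\<^sub>x\<close>.\<close>

definition sample_inner :: "'a list \<Rightarrow> ('a \<Rightarrow> real) \<Rightarrow> ('a \<Rightarrow> real) \<Rightarrow> real" where
  "sample_inner xs f g = (\<Sum>x\<in>set xs. f x * g x) / real (card (set xs))"

text \<open>As usual in several variables, an orthogonal polynomial of degree \<open>k\<close> is a polynomial of degree
  at most \<open>k\<close> that is orthogonal to all polynomials of smaller degree.\<close>

definition discrete_orthogonal_poly ::
  "(real ^ 'd) list \<Rightarrow> nat \<Rightarrow> (real ^ 'd \<Rightarrow> real) \<Rightarrow> bool" where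
  "discrete_orthogonal_poly xs k p \<longleftrightarrow>
     p \<in> poly_space k \<and> (\<forall>r < k. \<forall>f \<in> poly_space r. sample_inner xs p f = 0)"

text \<open>The scaling distributions are given by the values at the sites of discrete orthogonal polynomials
  and are ordered by increasing degree. Mutual orthogonality and normalisation are part of
  \<^const>\<open>samplet_basis\<close>: the inner product of two distributions of this form is \<open>N\<close> times
  the \<^const>\<open>sample_inner\<close> of the polynomials.\<close>

definition scaling_ordered_by_degree ::
  "(real ^ 'd) list \<Rightarrow> ((real ^ 'd \<Rightarrow> real) \<Rightarrow> real) list \<Rightarrow> bool" where
  "scaling_ordered_by_degree xs fs \<longleftrightarrow>
     (\<exists>ks \<pi>. length ks = length fs \<and> sorted ks \<and>
        (\<forall>i < length fs. discrete_orthogonal_poly xs (ks ! i) (\<pi> i) \<and>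
           fs ! i = (\<Sum>x\<in>set xs. \<pi> i x *\<^sub>R dirac x)))"

definition samplet_transform ::
  "'a list \<Rightarrow> (('a \<Rightarrow> real) \<Rightarrow> real) list \<Rightarrow> real mat" where
  "samplet_transform xs bs =
     mat (length bs) (length xs) (\<lambda>(i, k). dirac_coeff xs (bs ! i) (xs ! k))"


section \<open>Matrices\<close>

definition mat_range :: "real mat \<Rightarrow> real vec set" where
  "mat_range A = {A *\<^sub>v v | v. v \<in> carrier_vec (dim_col A)}"

definition orthogonal_projector :: "nat \<Rightarrow> real vec set \<Rightarrow> real mat \<Rightarrow> bool" where
  "orthogonal_projector m U Q \<longleftrightarrow>
     Q \<in> carrier_mat m m \<and> Q * Q = Q \<and> transpose_mat Q = Q \<and> mat_range Q = U"

text \<open>Definiteness of a symmetric matrix as a quadratic form on a subspace \<open>U\<close>.\<close>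

definition pos_def_on :: "real vec set \<Rightarrow> real mat \<Rightarrow> bool" where
  "pos_def_on U A \<longleftrightarrow> transpose_mat A = A \<and>
     (\<forall>v \<in> U. v \<noteq> 0\<^sub>v (dim_row A) \<longrightarrow> v \<bullet> (A *\<^sub>v v) > 0)"

definition pos_semidef_on :: "real vec set \<Rightarrow> real mat \<Rightarrow> bool" where
  "pos_semidef_on U A \<longleftrightarrow> transpose_mat A = A \<and> (\<forall>v \<in> U. v \<bullet> (A *\<^sub>v v) \<ge> 0)"

abbreviation pos_def_mat :: "real mat \<Rightarrow> bool" where
  "pos_def_mat A \<equiv> pos_def_on (carrier_vec (dim_row A)) A"

abbreviation pos_semidef_mat :: "real mat \<Rightarrow> bool" where
  "pos_semidef_mat A \<equiv> pos_semidef_on (carrier_vec (dim_row A)) A"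

end

theory Submission
  imports Defs
begin

text \<open>The samplet transform \<open>T\<close> is orthogonal, so the quadratic form of \<open>T K T\<^sup>T\<close> at \<open>v\<close> is that of
  \<open>K\<close> at \<open>c = T\<^sup>T v\<close>. If \<open>T P\<close> vanishes below its first \<open>n\<close> rows and \<open>v\<close> vanishes in its first
  \<open>n\<close> entries, then \<open>P\<^sup>T c = (T P)\<^sup>T v = 0\<close>, so \<open>c\<close> is one of the vectors for which conditional
  definiteness of the kernel says something (lemma \<open>congruence_on_trailing_coordinates\<close>). What
  remains is to justify the block structure that the argument uses.

  \<^item> \<open>T P\<close> vanishes below row \<open>n\<close> (lemma \<open>samplet_basis_annihilates\<close>). Samplets annihilate
    polynomials of degree at most \<open>q\<close> by the vanishing moments, and so do the scaling distributions
    of degree above \<open>q\<close>, by orthogonality of their polynomials. The other scaling distributions are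
    images of elements of the \<open>n\<close>-dimensional polynomial space under a linear map; being
    orthonormal they are independent, so there are at most \<open>n\<close> of them, and by the ordering they
    come first.
  \<^item> \<open>Q = diag(I, 0)\<close> (lemmas \<open>range_of_full_rank_upper_block\<close> and
    \<open>orthogonal_projector_leading_coordinates\<close>). Unisolvence makes \<open>P\<close>, hence \<open>T P\<close>, injective. So
    the upper \<open>n \<times> n\<close> block of \<open>T P\<close> is invertible, the range of \<open>T P\<close> consists of all vectors
    supported in the first \<open>n\<close> coordinates, and only one symmetric idempotent has that range.

  Since \<open>I - Q = diag(0, I)\<close>, compressing with it keeps exactly the trailing block, and its range
  consists of the vectors \<open>(0, u)\<close>, on which the form of \<open>T K T\<^sup>T\<close> is the form of that block
  at \<open>u\<close>.\<close>


section \<open>Dirac functionals and their coefficients\<close>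

lemma sum_nth_distinct:
  assumes "distinct xs"
  shows "(\<Sum>k<length xs. f (xs ! k)) = (\<Sum>x\<in>set xs. f x)"
  by (rule sum.reindex_bij_betw[OF bij_betw_nth[OF assms refl refl]])

lemma sum_scaleR_functional_apply:
  fixes \<sigma> :: "'b \<Rightarrow> ('a \<Rightarrow> real) \<Rightarrow> real"
  shows "(\<Sum>x\<in>A. c x *\<^sub>R \<sigma> x) f = (\<Sum>x\<in>A. c x * \<sigma> x f)"
  by (induction A rule: infinite_finite_induct) (simp_all add: scaleR_fun_def)

lemma inj_dirac: "inj_on dirac A"
proof (rule inj_onI)
  fix x y :: 'a
  assume "dirac x = dirac y"
  then have "dirac x (\<lambda>z. if z = x then 1 else 0) = dirac y (\<lambda>z. if z = x then 1 else 0)"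
    by simp
  then show "x = y"
    by (simp add: dirac_def split: if_splits)
qed

lemma independent_dirac:
  fixes A :: "'a set"
  assumes "finite A"
  shows "independent (dirac ` A)"
proof
  assume "dependent (dirac ` A)"
  then obtain c \<tau> where zero: "(\<Sum>\<sigma>\<in>dirac ` A. c \<sigma> *\<^sub>R \<sigma>) = 0"
    and "\<tau> \<in> dirac ` A" "c \<tau> \<noteq> 0"
    using assms by (auto simp: real_vector.dependent_finite)
  from \<open>\<tau> \<in> dirac ` A\<close> obtain y where y: "y \<in> A" "\<tau> = dirac y"
    by auto
  have "(\<Sum>\<sigma>\<in>dirac ` A. c \<sigma> *\<^sub>R \<sigma>) = (\<Sum>x\<in>A. c (dirac x) *\<^sub>R dirac x)"
    by (rule sum.reindex_cong[OF inj_dirac refl refl])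
  then have "0 = (\<Sum>x\<in>A. c (dirac x) *\<^sub>R dirac x) (\<lambda>z. if z = y then 1 else 0)"
    using zero by simp
  also have "\<dots> = (\<Sum>x\<in>A. if x = y then c (dirac x) else 0)"
    unfolding sum_scaleR_functional_apply by (rule sum.cong) (auto simp: dirac_def)
  also have "\<dots> = c \<tau>"
    using y assms by simp
  finally show False
    using \<open>c \<tau> \<noteq> 0\<close> by simp
qed

lemma dual_space_apply:
  assumes "\<sigma> \<in> dual_space xs"
  shows "\<sigma> f = (\<Sum>x\<in>set xs. dirac_coeff xs \<sigma> x * f x)"
proof -
  have "\<sigma> = (\<Sum>\<tau>\<in>dirac ` set xs. representation (dirac ` set xs) \<sigma> \<tau> *\<^sub>R \<tau>)"
    using assms by (simp add: real_vector.sum_representation_eq independent_dirac dual_space_def)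
  also have "\<dots> = (\<Sum>x\<in>set xs. dirac_coeff xs \<sigma> x *\<^sub>R dirac x)"
    unfolding dirac_coeff_def by (rule sum.reindex_cong[OF inj_dirac refl refl])
  finally have "\<sigma> f = (\<Sum>x\<in>set xs. dirac_coeff xs \<sigma> x *\<^sub>R dirac x) f"
    by (rule fun_cong)
  then show ?thesis
    unfolding sum_scaleR_functional_apply by (simp add: dirac_def)
qed

text \<open>Pairing with a fixed \<open>\<tau>\<close> is evaluation at the function of its coefficients, so the
  inner product inherits linearity in its first argument from evaluation.\<close>

lemma dual_inner_eq_apply:
  assumes "\<sigma> \<in> dual_space xs"
  shows "dual_inner xs \<sigma> \<tau> = \<sigma> (dirac_coeff xs \<tau>)"
  unfolding dual_inner_def by (rule dual_space_apply[OF assms, symmetric])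


section \<open>Orthonormal bases and the samplet transform\<close>

lemma orthonormal_basis_in_dual_space:
  assumes "orthonormal_basis xs (dual_space xs) bs" and "i < length bs"
  shows "bs ! i \<in> dual_space xs"
  using assms real_vector.span_base[of "bs ! i" "set bs"] by (auto simp: orthonormal_basis_def)

lemma orthonormal_basis_distinct:
  assumes "orthonormal_basis xs U bs"
  shows "distinct bs"
  unfolding distinct_conv_nth
proof (intro allI impI notI)
  fix i j assume ij: "i < length bs" "j < length bs" "i \<noteq> j" and eq: "bs ! i = bs ! j"
  have "dual_inner xs (bs ! i) (bs ! j) = 0" "dual_inner xs (bs ! j) (bs ! j) = 1"
    using assms ij by (auto simp: orthonormal_basis_def)
  with eq show False
    by simp
qed

lemma orthonormal_basis_independent:
  assumes onb: "orthonormal_basis xs (dual_space xs) bs"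
  shows "independent (set bs)"
proof
  assume "dependent (set bs)"
  then obtain c \<sigma> where zero: "(\<Sum>\<tau>\<in>set bs. c \<tau> *\<^sub>R \<tau>) = 0"
    and "\<sigma> \<in> set bs" "c \<sigma> \<noteq> 0"
    by (auto simp: real_vector.dependent_finite)
  from \<open>\<sigma> \<in> set bs\<close> obtain j where j: "j < length bs" "\<sigma> = bs ! j"
    by (auto simp: in_set_conv_nth)
  have "0 = (\<Sum>\<tau>\<in>set bs. c \<tau> *\<^sub>R \<tau>) (dirac_coeff xs \<sigma>)"
    using zero by simp
  also have "\<dots> = (\<Sum>\<tau>\<in>set bs. c \<tau> * \<tau> (dirac_coeff xs \<sigma>))"
    by (rule sum_scaleR_functional_apply)
  also have "\<dots> = (\<Sum>i<length bs. c (bs ! i) * (bs ! i) (dirac_coeff xs \<sigma>))"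
    by (rule sum_nth_distinct[OF orthonormal_basis_distinct[OF onb], symmetric])
  also have "\<dots> = (\<Sum>i<length bs. if i = j then c \<sigma> else 0)"
  proof (rule sum.cong)
    fix i assume "i \<in> {..<length bs}"
    then have i: "i < length bs"
      by simp
    have "(bs ! i) (dirac_coeff xs \<sigma>) = (if i = j then 1 else 0)"
      using onb i j
      by (simp add: dual_inner_eq_apply[OF orthonormal_basis_in_dual_space[OF onb i], symmetric]
          orthonormal_basis_def)
    with j show "c (bs ! i) * (bs ! i) (dirac_coeff xs \<sigma>) = (if i = j then c \<sigma> else 0)"
      by simp
  qed simp
  also have "\<dots> = c \<sigma>"
    using j by simp
  finally show False
    using \<open>c \<sigma> \<noteq> 0\<close> by simp
qed

lemma orthonormal_basis_length:
  assumes "distinct xs" and onb: "orthonormal_basis xs (dual_space xs) bs"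
  shows "length bs = length xs"
proof -
  have "length bs = real_vector.dim (span (set bs))"
    using orthonormal_basis_distinct[OF onb]
    by (simp add: real_vector.dim_eq_card_independent[OF orthonormal_basis_independent[OF onb]]
        distinct_card)
  also have "span (set bs) = span (dirac ` set xs)"
    using onb by (simp add: orthonormal_basis_def dual_space_def)
  also have "real_vector.dim \<dots> = length xs"
    using assms(1)
    by (simp add: real_vector.dim_eq_card_independent[OF independent_dirac] distinct_card
        card_image[OF inj_dirac])
  finally show ?thesis .
qed

lemma samplet_transform_orthogonal:
  assumes "distinct xs" and onb: "orthonormal_basis xs (dual_space xs) bs"
  shows "samplet_transform xs bs * transpose_mat (samplet_transform xs bs) = 1\<^sub>m (length xs)"
proof (rule eq_matI)
  let ?T = "samplet_transform xs bs"
  note len = orthonormal_basis_length[OF assms]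
  fix i j assume "i < dim_row (1\<^sub>m (length xs) :: real mat)" "j < dim_col (1\<^sub>m (length xs) :: real mat)"
  then have ij: "i < length xs" "j < length xs"
    by simp_all
  have "(?T * transpose_mat ?T) $$ (i, j) =
      (\<Sum>k<length xs. dirac_coeff xs (bs ! i) (xs ! k) * dirac_coeff xs (bs ! j) (xs ! k))"
    using ij len by (simp add: samplet_transform_def scalar_prod_def lessThan_atLeast0)
  also have "\<dots> = dual_inner xs (bs ! i) (bs ! j)"
    unfolding dual_inner_def by (rule sum_nth_distinct[OF assms(1)])
  also have "\<dots> = 1\<^sub>m (length xs) $$ (i, j)"
    using onb ij len by (simp add: orthonormal_basis_def)
  finally show "(?T * transpose_mat ?T) $$ (i, j) = 1\<^sub>m (length xs) $$ (i, j)" .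
qed (use orthonormal_basis_length[OF assms] in \<open>simp_all add: samplet_transform_def\<close>)

lemma samplet_transform_poly_mat_index:
  assumes "distinct xs" and onb: "orthonormal_basis xs (dual_space xs) bs"
    and i: "i < length bs" and j: "j < length ps"
  shows "(samplet_transform xs bs * poly_mat ps xs) $$ (i, j) = (bs ! i) (ps ! j)"
proof -
  have "(samplet_transform xs bs * poly_mat ps xs) $$ (i, j) =
      (\<Sum>k<length xs. dirac_coeff xs (bs ! i) (xs ! k) * (ps ! j) (xs ! k))"
    using i j
    by (simp add: samplet_transform_def poly_mat_def scalar_prod_def lessThan_atLeast0)
  also have "\<dots> = (\<Sum>x\<in>set xs. dirac_coeff xs (bs ! i) x * (ps ! j) x)"
    by (rule sum_nth_distinct[OF assms(1)])
  also have "\<dots> = (bs ! i) (ps ! j)"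
    by (rule dual_space_apply[OF orthonormal_basis_in_dual_space[OF onb i], symmetric])
  finally show ?thesis .
qed


section \<open>Vanishing moments beyond the dimension of the polynomial space\<close>

lemma poly_space_mono: "p \<le> q \<Longrightarrow> poly_space p \<subseteq> poly_space q"
  unfolding poly_space_def by (rule real_vector.span_mono) (blast intro: order_trans)

text \<open>The functional with the values of a function at the sites as coefficients. Linearity turns the
  dimension of the polynomial space into a bound for the number of independent functionals that
  come from polynomials of degree at most \<open>q\<close>.\<close>

lemma linear_values_functional: "linear (\<lambda>p. \<Sum>x\<in>(A :: 'a set). p x *\<^sub>R dirac x)"
proof (rule linearI)
  show "(\<Sum>x\<in>A. (p + q) x *\<^sub>R dirac x) = (\<Sum>x\<in>A. p x *\<^sub>R dirac x) + (\<Sum>x\<in>A. q x *\<^sub>R dirac x)"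
    for p q :: "'a \<Rightarrow> real"
    by (simp add: scaleR_add_left sum.distrib)
  show "(\<Sum>x\<in>A. (r *\<^sub>R p) x *\<^sub>R dirac x) = r *\<^sub>R (\<Sum>x\<in>A. p x *\<^sub>R dirac x)"
    for r and p :: "'a \<Rightarrow> real"
  proof -
    have "(r *\<^sub>R p) x = r * p x" for x
      by (simp add: scaleR_fun_def)
    then show ?thesis
      by (simp add: scaleR_sum_right)
  qed
qed

text \<open>Sortedness of the degrees is what makes counting sufficient: if the element at position \<open>i\<close> had
  degree at most \<open>q\<close>, so would all earlier ones, which is one more than the dimension permits.\<close>

lemma samplet_basis_annihilates:
  fixes ps :: "(real ^ 'd \<Rightarrow> real) list" and xs :: "(real ^ 'd) list"
  assumes basis: "poly_basis q ps" and samplets: "samplet_basis xs J V fs gs"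
    and moments: "vanishing_moments q xs J V" and scaling: "scaling_ordered_by_degree xs fs"
    and i: "length ps \<le> i" "i < length (fs @ gs)" and p: "p \<in> poly_space q"
  shows "((fs @ gs) ! i) p = 0"
proof (cases "i < length fs")
  case False
  then have "(fs @ gs) ! i \<in> set gs"
    using i by (simp add: nth_append)
  then obtain j where "j < J" "(fs @ gs) ! i \<in> detail_space xs V j"
    using samplets by (auto simp: samplet_basis_def)
  with moments p show ?thesis
    by (simp add: vanishing_moments_def)
next
  case True
  obtain ks \<pi> where len: "length ks = length fs" and sorted: "sorted ks"
    and dop: "\<And>j. j < length fs \<Longrightarrow> discrete_orthogonal_poly xs (ks ! j) (\<pi> j)"
    and fs: "\<And>j. j < length fs \<Longrightarrow> fs ! j = (\<Sum>x\<in>set xs. \<pi> j x *\<^sub>R dirac x)"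
    using scaling unfolding scaling_ordered_by_degree_def by blast
  let ?L = "\<lambda>p. \<Sum>x\<in>set xs. p x *\<^sub>R dirac x"
  have "q < ks ! i"
  proof (rule ccontr)
    assume "\<not> q < ks ! i"
    have onb: "orthonormal_basis xs (dual_space xs) (fs @ gs)"
      using samplets by (simp add: samplet_basis_def)
    have "set (take (Suc i) fs) \<subseteq> set (fs @ gs)"
      using set_take_subset[of "Suc i" fs] by auto
    then have indep: "independent (set (take (Suc i) fs))"
      using orthonormal_basis_independent[OF onb] real_vector.independent_mono by blast
    have "set (take (Suc i) fs) \<subseteq> ?L ` poly_space q"
    proof
      fix \<sigma> assume "\<sigma> \<in> set (take (Suc i) fs)"
      then obtain j where j: "j \<le> i" "j < length fs" "\<sigma> = fs ! j"
        by (auto simp: in_set_conv_nth less_Suc_eq_le)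
      have "ks ! j \<le> q"
        using sorted_nth_mono[OF sorted j(1)] True len \<open>\<not> q < ks ! i\<close> by simp
      then have "\<pi> j \<in> poly_space q"
        using dop[OF j(2)] poly_space_mono[of "ks ! j" q]
        by (auto simp: discrete_orthogonal_poly_def)
      with fs[OF j(2)] j(3) show "\<sigma> \<in> ?L ` poly_space q"
        by blast
    qed
    also have "\<dots> = span (?L ` set ps)"
      using basis linear_span_image[OF linear_values_functional[of "set xs"], of "set ps"]
      by (simp add: poly_basis_def)
    finally have "card (set (take (Suc i) fs)) \<le> card (?L ` set ps)"
      using real_vector.independent_span_bound[OF _ indep] by simp
    also have "\<dots> \<le> length ps"
      using card_image_le[OF finite_set, of ?L ps] card_length[of ps] by linarith
    also have "card (set (take (Suc i) fs)) = Suc i"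
      using orthonormal_basis_distinct[OF onb] True by (simp add: distinct_card)
    finally show False
      using i(1) by simp
  qed
  then have "sample_inner xs (\<pi> i) p = 0"
    using dop[OF True] p by (simp add: discrete_orthogonal_poly_def)
  then have "(\<Sum>x\<in>set xs. \<pi> i x * p x) = 0"
    by (cases "set xs = {}") (simp_all add: sample_inner_def)
  then show ?thesis
    using True fs[OF True]
    by (simp add: nth_append sum_scaleR_functional_apply dirac_def)
qed


section \<open>Projecting onto the leading coordinates\<close>

lemma mult_mat_vec_zero:
  fixes A :: "'a :: semiring_0 mat"
  shows "A \<in> carrier_mat m k \<Longrightarrow> A *\<^sub>v 0\<^sub>v k = 0\<^sub>v m"
  by (intro eq_vecI) (auto simp: scalar_prod_def)

lemma zero_mat_mult_vec:
  fixes v :: "'a :: semiring_0 vec"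
  shows "v \<in> carrier_vec k \<Longrightarrow> 0\<^sub>m m k *\<^sub>v v = 0\<^sub>v m"
  by (intro eq_vecI) (auto simp: scalar_prod_def)

text \<open>A repeated column would leave fewer than \<open>k\<close> vectors to span the column space. Hence full rank
  forces the columns to be distinct, and only then does independence of the set of columns say that
  the matrix is injective.\<close>

lemma full_column_rank:
  fixes A :: "real mat"
  assumes A: "A \<in> carrier_mat m k" and rank: "vec_space.rank m A = k"
  shows full_column_rank_inj: "\<And>v. v \<in> carrier_vec k \<Longrightarrow> A *\<^sub>v v = 0\<^sub>v m \<Longrightarrow> v = 0\<^sub>v k"
    and full_column_rank_le: "k \<le> m"
proof -
  interpret vec_space "TYPE(real)" m .
  have cols: "set (cols A) \<subseteq> carrier_vec m"
    using A cols_dim by blast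
  obtain S where S: "maximal S (\<lambda>T. T \<subseteq> set (cols A) \<and> lin_indpt T)"
    using maximal_exists_superset[of "set (cols A)" "\<lambda>T. T \<subseteq> set (cols A) \<and> lin_indpt T" "{}"]
      finite_lin_indpt2[of "{}"] by auto
  then have sub: "S \<subseteq> set (cols A)" "lin_indpt S"
    by (simp_all add: maximal_def)
  have card: "card S = k"
    using rank_card_indpt[OF A S] rank by simp
  have "k \<le> card (set (cols A))"
    using card_mono[OF _ sub(1)] card by simp
  then have "distinct (cols A)"
    using A card_length[of "cols A"] by (intro card_distinct) simp
  then show "\<And>v. v \<in> carrier_vec k \<Longrightarrow> A *\<^sub>v v = 0\<^sub>v m \<Longrightarrow> v = 0\<^sub>v k"
    using full_rank_lin_indpt[OF A rank] lin_depI[OF A] by blast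
  show "k \<le> m"
    using li_le_dim(2)[OF fin_dim _ sub(2)] sub(1) cols card dim_is_n by auto
qed

text \<open>With zeros below, injectivity passes to the upper square block, where it implies surjectivity.\<close>

lemma range_of_full_rank_upper_block:
  fixes A :: "real mat"
  assumes A: "A \<in> carrier_mat N n" and "n \<le> N"
    and inj: "\<And>v. v \<in> carrier_vec n \<Longrightarrow> A *\<^sub>v v = 0\<^sub>v N \<Longrightarrow> v = 0\<^sub>v n"
    and zero: "\<And>i j. n \<le> i \<Longrightarrow> i < N \<Longrightarrow> j < n \<Longrightarrow> A $$ (i, j) = 0"
  shows "mat_range A = {w \<in> carrier_vec N. \<forall>i. n \<le> i \<and> i < N \<longrightarrow> w $ i = 0}"
proof -
  define R where "R = mat n n (\<lambda>(i, j). A $$ (i, j))"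
  have R: "R \<in> carrier_mat n n"
    by (simp add: R_def)
  have Av: "A *\<^sub>v v = vec N (\<lambda>i. if i < n then (R *\<^sub>v v) $ i else 0)" if "v \<in> carrier_vec n" for v
    using that A \<open>n \<le> N\<close> zero by (intro eq_vecI) (auto simp: R_def scalar_prod_def)
  have "det R \<noteq> 0"
  proof
    assume "det R = 0"
    then obtain v where v: "v \<in> carrier_vec n" "v \<noteq> 0\<^sub>v n" "R *\<^sub>v v = 0\<^sub>v n"
      using det_0_iff_vec_prod_zero_field[OF R] by blast
    have "A *\<^sub>v v = 0\<^sub>v N"
      unfolding Av[OF v(1)] using v(3) by (intro eq_vecI) auto
    with inj v show False
      by blast
  qed
  then obtain B where B: "B \<in> carrier_mat n n" "R * B = 1\<^sub>m n"
    using det_non_zero_imp_unit[OF R, of "()"] by (auto simp: Units_def ring_mat_def)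
  show ?thesis
  proof (intro equalityI subsetI)
    fix w assume "w \<in> mat_range A"
    then obtain v where "v \<in> carrier_vec n" "w = A *\<^sub>v v"
      using A by (auto simp: mat_range_def)
    then show "w \<in> {w \<in> carrier_vec N. \<forall>i. n \<le> i \<and> i < N \<longrightarrow> w $ i = 0}"
      using Av by auto
  next
    fix w :: "real vec"
    assume w: "w \<in> {w \<in> carrier_vec N. \<forall>i. n \<le> i \<and> i < N \<longrightarrow> w $ i = 0}"
    define v where "v = B *\<^sub>v vec n (\<lambda>i. w $ i)"
    have v: "v \<in> carrier_vec n"
      using B by (simp add: v_def)
    have "R *\<^sub>v v = vec n (\<lambda>i. w $ i)"
      unfolding v_def by (subst assoc_mult_mat_vec[OF R B(1), symmetric]) (simp_all add: B(2))
    then have "A *\<^sub>v v = w"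
      unfolding Av[OF v] using w by (intro eq_vecI) auto
    then show "w \<in> mat_range A"
      using v A by (auto simp: mat_range_def)
  qed
qed

text \<open>A projector fixes its range, so its first \<open>n\<close> columns are unit vectors; by symmetry so are its
  first \<open>n\<close> rows, and the remaining entries vanish because the columns lie in the range.\<close>

lemma orthogonal_projector_leading_coordinates:
  assumes "n \<le> N"
    and proj: "orthogonal_projector N {w \<in> carrier_vec N. \<forall>i. n \<le> i \<and> i < N \<longrightarrow> w $ i = 0} Q"
  shows "Q = mat N N (\<lambda>(i, j). if i = j \<and> i < n then 1 else 0)"
proof -
  let ?U = "{w \<in> carrier_vec N. \<forall>i. n \<le> i \<and> i < N \<longrightarrow> w $ i = (0 :: real)}"
  have Q: "Q \<in> carrier_mat N N" and idem: "Q * Q = Q" and sym: "transpose_mat Q = Q"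
    and range: "mat_range Q = ?U"
    using proj by (simp_all add: orthogonal_projector_def)
  have fixed: "Q *\<^sub>v w = w" if "w \<in> ?U" for w
  proof -
    obtain v where v: "v \<in> carrier_vec N" "w = Q *\<^sub>v v"
      using \<open>w \<in> ?U\<close> Q unfolding range[symmetric] by (auto simp: mat_range_def)
    then show ?thesis
      using assoc_mult_mat_vec[OF Q Q v(1)] idem by simp
  qed
  have entry: "Q $$ (i, j) = (Q *\<^sub>v unit_vec N j) $ i" if "i < N" "j < N" for i j
    using that Q by simp
  have leading: "Q $$ (i, j) = (if i = j then 1 else 0)" if "i < N" "j < n" for i j
  proof -
    have "unit_vec N j \<in> ?U"
      using that \<open>n \<le> N\<close> by auto
    then show ?thesis
      using entry[of i j] fixed[of "unit_vec N j"] that \<open>n \<le> N\<close> by simp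
  qed
  have trailing: "Q $$ (i, j) = 0" if "n \<le> i" "i < N" "j < N" for i j
  proof -
    have "Q *\<^sub>v unit_vec N j \<in> ?U"
      unfolding range[symmetric] using Q by (auto simp: mat_range_def)
    then show ?thesis
      using entry[of i j] that by simp
  qed
  have swap: "Q $$ (i, j) = Q $$ (j, i)" if "i < N" "j < N" for i j
    using that Q arg_cong[OF sym, of "\<lambda>M. M $$ (i, j)"] by simp
  show ?thesis
  proof (rule eq_matI)
    fix i j
    assume "i < dim_row (mat N N (\<lambda>(i, j). if i = j \<and> i < n then 1 else 0 :: real))"
      "j < dim_col (mat N N (\<lambda>(i, j). if i = j \<and> i < n then 1 else 0 :: real))"
    then have ij: "i < N" "j < N"
      by simp_all
    have "Q $$ (i, j) = (if i = j \<and> i < n then 1 else 0)"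
    proof (cases "i < n")
      case True
      then show ?thesis
        using swap[OF ij] leading[of j i] ij by auto
    qed (use trailing ij in auto)
    then show "Q $$ (i, j) = mat N N (\<lambda>(i, j). if i = j \<and> i < n then 1 else 0) $$ (i, j)"
      using ij by simp
  qed (use Q in auto)
qed


section \<open>Compressing a conditionally definite matrix\<close>

text \<open>The zero rows of \<open>T P\<close> and the zero entries of \<open>v\<close> are complementary, so
  \<open>P\<^sup>T (T\<^sup>T v) = (T P)\<^sup>T v\<close> is a sum of zeros.\<close>

lemma congruence_on_trailing_coordinates:
  fixes T K P :: "real mat"
  assumes T: "T \<in> carrier_mat N N" "T * transpose_mat T = 1\<^sub>m N"
    and K: "K \<in> carrier_mat N N" and P: "P \<in> carrier_mat N n"
    and zero: "\<And>i j. n \<le> i \<Longrightarrow> i < N \<Longrightarrow> j < n \<Longrightarrow> (T * P) $$ (i, j) = 0"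
    and v: "v \<in> carrier_vec N" "\<And>i. i < n \<Longrightarrow> v $ i = 0"
  shows congruence_in_kernel: "transpose_mat T *\<^sub>v v \<in> mat_kernel (transpose_mat P)"
    and congruence_nonzero: "v \<noteq> 0\<^sub>v N \<Longrightarrow> transpose_mat T *\<^sub>v v \<noteq> 0\<^sub>v N"
    and congruence_form: "v \<bullet> (T * K * transpose_mat T *\<^sub>v v) =
      (transpose_mat T *\<^sub>v v) \<bullet> (K *\<^sub>v (transpose_mat T *\<^sub>v v))"
proof -
  let ?c = "transpose_mat T *\<^sub>v v"
  have Tt: "transpose_mat T \<in> carrier_mat N N" and Pt: "transpose_mat P \<in> carrier_mat n N"
    using T P by simp_all
  have c: "?c \<in> carrier_vec N"
    using Tt v by simp
  have "transpose_mat P *\<^sub>v ?c = transpose_mat (T * P) *\<^sub>v v"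
    using assoc_mult_mat_vec[OF Pt Tt v(1)] transpose_mult[OF T(1) P] by simp
  also have "\<dots> = 0\<^sub>v n"
  proof (rule eq_vecI)
    fix j assume "j < dim_vec (0\<^sub>v n :: real vec)"
    then have j: "j < n"
      by simp
    have "(transpose_mat (T * P) *\<^sub>v v) $ j = (\<Sum>i = 0..<N. (T * P) $$ (i, j) * v $ i)"
      using j T P v(1) by (simp add: scalar_prod_def)
    also have "\<dots> = 0"
    proof (rule sum.neutral, intro ballI)
      fix i assume "i \<in> {0..<N}"
      then show "(T * P) $$ (i, j) * v $ i = 0"
        using zero[of i j] v(2)[of i] j by (cases "i < n") auto
    qed
    finally show "(transpose_mat (T * P) *\<^sub>v v) $ j = 0\<^sub>v n $ j"
      using j by simp
  qed (use P in simp)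
  finally show "?c \<in> mat_kernel (transpose_mat P)"
    by (rule mat_kernelI[OF Pt c])
  have "T *\<^sub>v ?c = v"
    using assoc_mult_mat_vec[OF T(1) Tt v(1)] T(2) v(1) by simp
  then show "v \<noteq> 0\<^sub>v N \<Longrightarrow> ?c \<noteq> 0\<^sub>v N"
    using T(1) by (metis mult_mat_vec_zero)
  have Kc: "K *\<^sub>v ?c \<in> carrier_vec N"
    using K c by simp
  have "T * K * transpose_mat T *\<^sub>v v = T *\<^sub>v (K *\<^sub>v ?c)"
    using assoc_mult_mat_vec[OF mult_carrier_mat[OF T(1) K] Tt v(1)]
      assoc_mult_mat_vec[OF T(1) K c] by simp
  then show "v \<bullet> (T * K * transpose_mat T *\<^sub>v v) = ?c \<bullet> (K *\<^sub>v ?c)"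
    using transpose_vec_mult_scalar[OF T(1) Kc v(1)] by simp
qed

lemma compress_to_trailing_block:
  fixes A B C E :: "'a :: comm_ring_1 mat"
  assumes "A \<in> carrier_mat n n" "B \<in> carrier_mat n k" "C \<in> carrier_mat k n" "E \<in> carrier_mat k k"
  defines "F \<equiv> four_block_mat (0\<^sub>m n n) (0\<^sub>m n k) (0\<^sub>m k n) (1\<^sub>m k)"
  shows "F * four_block_mat A B C E * F = four_block_mat (0\<^sub>m n n) (0\<^sub>m n k) (0\<^sub>m k n) E"
proof -
  have "F * four_block_mat A B C E = four_block_mat (0\<^sub>m n n) (0\<^sub>m n k) C E"
    unfolding F_def using assms(1-4)
    by (subst mult_four_block_mat[of _ n n _ k _ k _ _ n _ k]) auto
  also have "\<dots> * F = four_block_mat (0\<^sub>m n n) (0\<^sub>m n k) (0\<^sub>m k n) E"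
    unfolding F_def using assms(1-4)
    by (subst mult_four_block_mat[of _ n n _ k _ k _ _ n _ k]) auto
  finally show ?thesis .
qed

lemma trailing_block_form:
  fixes A B C E :: "'a :: comm_ring_1 mat"
  assumes "A \<in> carrier_mat n n" "B \<in> carrier_mat n k" "C \<in> carrier_mat k n" "E \<in> carrier_mat k k"
    and "u \<in> carrier_vec k"
  shows "(0\<^sub>v n @\<^sub>v u) \<bullet> (four_block_mat A B C E *\<^sub>v (0\<^sub>v n @\<^sub>v u)) = u \<bullet> (E *\<^sub>v u)"
proof -
  have "four_block_mat A B C E *\<^sub>v (0\<^sub>v n @\<^sub>v u) = (B *\<^sub>v u) @\<^sub>v (E *\<^sub>v u)"
    using assms by (subst four_block_mat_mult_vec[of _ n n _ k _ k]) (auto simp: mult_mat_vec_zero)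
  then show ?thesis
    using assms by (simp add: scalar_prod_append[of _ n _ k])
qed

lemma range_trailing_coordinates:
  assumes "w \<in> mat_range (four_block_mat (0\<^sub>m n n) (0\<^sub>m n k) (0\<^sub>m k n) (1\<^sub>m k))"
  obtains u where "u \<in> carrier_vec k" "w = 0\<^sub>v n @\<^sub>v u"
proof -
  obtain v where v: "v \<in> carrier_vec (n + k)"
    and w: "w = four_block_mat (0\<^sub>m n n) (0\<^sub>m n k) (0\<^sub>m k n) (1\<^sub>m k) *\<^sub>v v"
    using assms by (auto simp: mat_range_def)
  have "w = four_block_mat (0\<^sub>m n n) (0\<^sub>m n k) (0\<^sub>m k n) (1\<^sub>m k) *\<^sub>v (vec_first v n @\<^sub>v vec_last v k)"
    using v w by simp
  also have "\<dots> = 0\<^sub>m n n *\<^sub>v vec_first v n @\<^sub>v 1\<^sub>m k *\<^sub>v vec_last v k"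
    by (rule mult_mat_vec_split) auto
  also have "\<dots> = 0\<^sub>v n @\<^sub>v vec_last v k"
    by (simp add: zero_mat_mult_vec)
  finally have "w = 0\<^sub>v n @\<^sub>v vec_last v k" .
  then show thesis
    using that[of "vec_last v k"] by simp
qed

lemma transpose_block_diag_zero:
  assumes "E \<in> carrier_mat k k" and "transpose_mat E = E"
  shows "transpose_mat (four_block_mat (0\<^sub>m n n) (0\<^sub>m n k) (0\<^sub>m k n) E) =
    four_block_mat (0\<^sub>m n n) (0\<^sub>m n k) (0\<^sub>m k n) E"
  using assms by (subst transpose_four_block_mat[of _ n n _ k _ k]) auto

lemma pos_def_on_trailing_coordinates:
  assumes E: "E \<in> carrier_mat k k" and pos: "pos_def_mat E"
  shows "pos_def_on (mat_range (four_block_mat (0\<^sub>m n n) (0\<^sub>m n k) (0\<^sub>m k n) (1\<^sub>m k)))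
    (four_block_mat (0\<^sub>m n n) (0\<^sub>m n k) (0\<^sub>m k n) E)" (is "pos_def_on ?U ?M")
  unfolding pos_def_on_def
proof (intro conjI ballI impI)
  show "transpose_mat ?M = ?M"
    using transpose_block_diag_zero[OF E] pos by (simp add: pos_def_on_def)
  fix w assume "w \<in> ?U" and "w \<noteq> 0\<^sub>v (dim_row ?M)"
  then obtain u where u: "u \<in> carrier_vec k" and w: "w = 0\<^sub>v n @\<^sub>v u"
    by (auto elim: range_trailing_coordinates)
  have "0\<^sub>v n @\<^sub>v 0\<^sub>v k = (0\<^sub>v (n + k) :: real vec)"
    by (intro eq_vecI) auto
  then have "u \<noteq> 0\<^sub>v k"
    using \<open>w \<noteq> _\<close> w E by auto
  then show "w \<bullet> (?M *\<^sub>v w) > 0"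
    unfolding w using pos u E by (subst trailing_block_form[OF _ _ _ E u]) (auto simp: pos_def_on_def)
qed

lemma pos_semidef_on_trailing_coordinates:
  assumes E: "E \<in> carrier_mat k k" and pos: "pos_semidef_mat E"
  shows "pos_semidef_on (mat_range (four_block_mat (0\<^sub>m n n) (0\<^sub>m n k) (0\<^sub>m k n) (1\<^sub>m k)))
    (four_block_mat (0\<^sub>m n n) (0\<^sub>m n k) (0\<^sub>m k n) E)" (is "pos_semidef_on ?U ?M")
  unfolding pos_semidef_on_def
proof (intro conjI ballI)
  show "transpose_mat ?M = ?M"
    using transpose_block_diag_zero[OF E] pos by (simp add: pos_semidef_on_def)
  fix w assume "w \<in> ?U"
  then obtain u where u: "u \<in> carrier_vec k" and w: "w = 0\<^sub>v n @\<^sub>v u"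
    by (auto elim: range_trailing_coordinates)
  show "w \<bullet> (?M *\<^sub>v w) \<ge> 0"
    unfolding w using pos u E
    by (subst trailing_block_form[OF _ _ _ E u]) (auto simp: pos_semidef_on_def)
qed


section \<open>Definiteness of the samplet block\<close>

theorem theorem3p7:
  fixes D :: "(real ^ 'd) set"
    and K :: "real ^ 'd \<Rightarrow> real ^ 'd \<Rightarrow> real"
    and q n N J :: nat
    and ps :: "(real ^ 'd \<Rightarrow> real) list"
    and xs :: "(real ^ 'd) list"
    and V :: "nat \<Rightarrow> ((real ^ 'd \<Rightarrow> real) \<Rightarrow> real) set"
    and fs gs :: "((real ^ 'd \<Rightarrow> real) \<Rightarrow> real) list"
    and T KS Q KPP KPS KSP KSS :: "real mat"
  assumes "bounded D" and "lipschitz_domain D"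
    and "poly_basis q ps" and "n = length ps"
    and "distinct xs" and "set xs \<subseteq> D" and "N = length xs"
    and "unisolvent ps xs"
    and "samplet_basis xs J V fs gs"
    and "vanishing_moments q xs J V"
    and "scaling_ordered_by_degree xs fs"
    and "T = samplet_transform xs (fs @ gs)"
    and "KS = T * kernel_mat K xs * transpose_mat T"
    and "orthogonal_projector N (mat_range (T * poly_mat ps xs)) Q"
    and "split_block KS n n = (KPP, KPS, KSP, KSS)"
  shows "(1\<^sub>m N - Q) * KS * (1\<^sub>m N - Q) =
           four_block_mat (0\<^sub>m n n) (0\<^sub>m n (N - n)) (0\<^sub>m (N - n) n) KSS \<and>
         (cond_pos_def ps D K \<longrightarrow>
            pos_def_on (mat_range (1\<^sub>m N - Q)) ((1\<^sub>m N - Q) * KS * (1\<^sub>m N - Q)) \<and>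
            pos_def_mat KSS) \<and>
         (cond_pos_semidef ps D K \<longrightarrow>
            pos_semidef_on (mat_range (1\<^sub>m N - Q)) ((1\<^sub>m N - Q) * KS * (1\<^sub>m N - Q)) \<and>
            pos_semidef_mat KSS)"
proof -
  define P where "P = poly_mat ps xs"
  define k where "k = N - n"
  note distinct = \<open>distinct xs\<close> and T_def = assms(12) and KS_def = assms(13)
  have onb: "orthonormal_basis xs (dual_space xs) (fs @ gs)"
    using \<open>samplet_basis xs J V fs gs\<close> by (simp add: samplet_basis_def)
  have len: "length (fs @ gs) = N"
    using orthonormal_basis_length[OF distinct onb] \<open>N = length xs\<close> by simp
  have T: "T \<in> carrier_mat N N"
    using len unfolding T_def \<open>N = length xs\<close> by (simp add: samplet_transform_def)
  have TTt: "T * transpose_mat T = 1\<^sub>m N"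
    using samplet_transform_orthogonal[OF distinct onb] T_def \<open>N = length xs\<close> by simp
  have TtT: "transpose_mat T * T = 1\<^sub>m N"
    using mat_mult_left_right_inverse[OF T _ TTt] T by simp
  have P: "P \<in> carrier_mat N n"
    using \<open>N = length xs\<close> \<open>n = length ps\<close> by (simp add: P_def poly_mat_def)
  have K: "kernel_mat K xs \<in> carrier_mat N N"
    using \<open>N = length xs\<close> by (simp add: kernel_mat_def)
  have TP: "T * P \<in> carrier_mat N n"
    using T P by simp
  have zero: "(T * P) $$ (i, j) = 0" if "n \<le> i" "i < N" "j < n" for i j
  proof -
    have "ps ! j \<in> poly_space q"
      using \<open>poly_basis q ps\<close> that \<open>n = length ps\<close> real_vector.span_base[of "ps ! j" "set ps"]
      by (simp add: poly_basis_def)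
    then have "((fs @ gs) ! i) (ps ! j) = 0"
      using samplet_basis_annihilates[OF \<open>poly_basis q ps\<close> \<open>samplet_basis xs J V fs gs\<close>
          \<open>vanishing_moments q xs J V\<close> \<open>scaling_ordered_by_degree xs fs\<close>] that len \<open>n = length ps\<close>
      by simp
    then show ?thesis
      using samplet_transform_poly_mat_index[OF distinct onb] that len \<open>n = length ps\<close> T_def
      by (simp add: P_def)
  qed
  have rank: "vec_space.rank N P = n"
    using \<open>unisolvent ps xs\<close> \<open>N = length xs\<close> \<open>n = length ps\<close> by (simp add: unisolvent_def P_def)
  have "n \<le> N"
    by (rule full_column_rank_le[OF P rank])
  then have N: "N = n + k"
    by (simp add: k_def)
  have inj: "v = 0\<^sub>v n" if v: "v \<in> carrier_vec n" and "T * P *\<^sub>v v = 0\<^sub>v N" for v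
  proof -
    have Pv: "P *\<^sub>v v \<in> carrier_vec N"
      using P v by simp
    have "P *\<^sub>v v = transpose_mat T *\<^sub>v (T *\<^sub>v (P *\<^sub>v v))"
      using assoc_mult_mat_vec[OF _ T Pv, of "transpose_mat T" N] T TtT Pv by simp
    also have "\<dots> = 0\<^sub>v N"
      using that assoc_mult_mat_vec[OF T P v] T by auto
    finally show ?thesis
      by (rule full_column_rank_inj[OF P rank v])
  qed
  have Q: "Q = mat N N (\<lambda>(i, j). if i = j \<and> i < n then 1 else 0)"
    using \<open>orthogonal_projector N _ Q\<close> range_of_full_rank_upper_block[OF TP \<open>n \<le> N\<close> inj zero]
    by (intro orthogonal_projector_leading_coordinates[OF \<open>n \<le> N\<close>]) (simp add: P_def)
  let ?F = "four_block_mat (0\<^sub>m n n) (0\<^sub>m n k) (0\<^sub>m k n) (1\<^sub>m k) :: real mat"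
  have F: "1\<^sub>m N - Q = ?F"
    unfolding Q by (rule eq_matI) (auto simp: N)
  have KS: "KS \<in> carrier_mat N N"
    using T K KS_def by simp
  have dims: "dim_row KS = n + k" "dim_col KS = n + k"
    using KS N by auto
  note blocks = split_block[OF \<open>split_block KS n n = _\<close> dims]
  have compressed: "(1\<^sub>m N - Q) * KS * (1\<^sub>m N - Q) =
      four_block_mat (0\<^sub>m n n) (0\<^sub>m n k) (0\<^sub>m k n) KSS"
    using compress_to_trailing_block[OF blocks(1-4)] by (simp add: F blocks(5)[symmetric])
  have symmetric: "transpose_mat KSS = KSS" if "symmetric_on D K"
  proof -
    have "transpose_mat (kernel_mat K xs) = kernel_mat K xs"
      using that \<open>set xs \<subseteq> D\<close>
      by (intro eq_matI) (auto simp: kernel_mat_def symmetric_on_def subset_iff)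
    then have "transpose_mat KS = KS"
      unfolding KS_def using T K
      by (simp add: transpose_mult[of _ N N _ N] assoc_mult_mat[of _ N N _ N _ N])
    then have "KS $$ (i, j) = KS $$ (j, i)" if "i < N" "j < N" for i j
      using that KS by (metis carrier_matD index_transpose_mat(1))
    moreover have "KSS $$ (i, j) = KS $$ (i + n, j + n)" if "i < k" "j < k" for i j
      using that blocks(1-4) by (subst blocks(5)) auto
    ultimately show ?thesis
      using blocks(4) N by (intro eq_matI) auto
  qed
  \<comment> \<open>Each value of the form of \<open>KSS\<close> is a value of the form of the kernel matrix on \<open>ker P\<^sup>T\<close>.\<close>
  have form: "\<exists>c \<in> mat_kernel (transpose_mat P). (u \<noteq> 0\<^sub>v k \<longrightarrow> c \<noteq> 0\<^sub>v N) \<and>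
      u \<bullet> (KSS *\<^sub>v u) = c \<bullet> (kernel_mat K xs *\<^sub>v c)" if u: "u \<in> carrier_vec k" for u
  proof (intro bexI conjI impI)
    let ?v = "0\<^sub>v n @\<^sub>v u"
    have v: "?v \<in> carrier_vec N" "\<And>i. i < n \<Longrightarrow> ?v $ i = 0"
      using u by (simp_all add: N)
    note congruence = T TTt K P zero v
    show "transpose_mat T *\<^sub>v ?v \<in> mat_kernel (transpose_mat P)"
      by (rule congruence_in_kernel[OF congruence])
    show "u \<bullet> (KSS *\<^sub>v u) =
        (transpose_mat T *\<^sub>v ?v) \<bullet> (kernel_mat K xs *\<^sub>v (transpose_mat T *\<^sub>v ?v))"
      using trailing_block_form[OF blocks(1-4) u] congruence_form[OF congruence] KS_def
      by (simp add: blocks(5)[symmetric])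
    assume "u \<noteq> 0\<^sub>v k"
    then have "?v \<noteq> 0\<^sub>v n @\<^sub>v 0\<^sub>v k"
      using append_vec_eq[of "0\<^sub>v n" n "0\<^sub>v n"] by auto
    also have "0\<^sub>v n @\<^sub>v 0\<^sub>v k = (0\<^sub>v N :: real vec)"
      by (intro eq_vecI) (auto simp: N)
    finally show "transpose_mat T *\<^sub>v ?v \<noteq> 0\<^sub>v N"
      using congruence_nonzero[OF congruence] by blast
  qed
  have dim: "dim_row KSS = k"
    using blocks(4) by simp
  have def: "pos_def_mat KSS" if "cond_pos_def ps D K"
    unfolding pos_def_on_def dim
  proof (intro conjI ballI impI)
    show "transpose_mat KSS = KSS"
      using that by (intro symmetric) (simp add: cond_pos_def_def)
    fix u :: "real vec" assume "u \<in> carrier_vec k" "u \<noteq> 0\<^sub>v k"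
    then obtain c where "c \<in> mat_kernel (transpose_mat P)" "c \<noteq> 0\<^sub>v N"
      "u \<bullet> (KSS *\<^sub>v u) = c \<bullet> (kernel_mat K xs *\<^sub>v c)"
      using form by blast
    then show "u \<bullet> (KSS *\<^sub>v u) > 0"
      using that distinct \<open>set xs \<subseteq> D\<close> \<open>N = length xs\<close> by (simp add: cond_pos_def_def P_def)
  qed
  have semidef: "pos_semidef_mat KSS" if "cond_pos_semidef ps D K"
    unfolding pos_semidef_on_def dim
  proof (intro conjI ballI)
    show "transpose_mat KSS = KSS"
      using that by (intro symmetric) (simp add: cond_pos_semidef_def)
    fix u :: "real vec" assume "u \<in> carrier_vec k"
    then obtain c where "c \<in> mat_kernel (transpose_mat P)"
      "u \<bullet> (KSS *\<^sub>v u) = c \<bullet> (kernel_mat K xs *\<^sub>v c)"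
      using form by blast
    then show "u \<bullet> (KSS *\<^sub>v u) \<ge> 0"
      using that distinct \<open>set xs \<subseteq> D\<close> by (simp add: cond_pos_semidef_def P_def)
  qed
  show ?thesis
    unfolding compressed unfolding F k_def[symmetric]
    using def semidef pos_def_on_trailing_coordinates[OF blocks(4)]
      pos_semidef_on_trailing_coordinates[OF blocks(4)]
    by simp
qed

end
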